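(* Let $\mathbb{G}=\mathbb{R}^{m_1}\times\mathbb{R}^{m_2}$ be a Carnot group of step $2$. Let $s\ge m_2$ and let $A\subset\mathbb{G}$ be such that $\mathcal{H}^s_E(A)<\infty$. Then for $\mathcal{H}^{s+m_2}_{\mathbb{G}}$-almost every $p\in A$ there exists $\delta>0$ such that $$\limsup_{r\to 0}\frac{\mathcal{H}^s_E\big((A\cap B_E(p,r))\setminus V(p)(\delta r)\big)}{(2r)^s}>\frac{1}{2^{s+1}}.$$
   Context: Carnot groups of step 2. A Carnot group of step $2$ is a connected, simply connected Lie group $\mathbb{G}$ whose Lie algebra $\mathfrak{g}$ has a decomposition $\mathfrak{g}=V_1\oplus V_2$ with $[V_1,V_1]=V_2\neq\{0\}$ and $[V_1,V_2]=\{0\}$. Put $m_i=\dim V_i$ and $n=m_1+m_2$. Using exponential coordinates, $\mathbb{G}$ is identified with $\mathbb{R}^n=\mathbb{R}^{m_1}\times\mathbb{R}^{m_2}$, points are written $p=[p^1,p^2]$ with $p^i\in\mathbb{R}^{m_i}$, and the group operation is $$[p^1,p^2]\cdot[q^1,q^2]=[p^1+q^1,\;p^2+q^2+P(p^1,q^1)],$$ where $P=(P_{m_1+1},\dots,P_n)$ and, for $p^1=(x_1,\dots,x_{m_1})$, $q^1=(y_1,\dots,y_{m_1})$, $P_j(p^1,q^1)=\sum_{1\le l<i\le m_1}b^j_{l,i}(x_ly_i-x_iy_l)$ for some constants $b^j_{l,i}\in\mathbb{R}$. Metrics. $d_E$ is the Euclidean metric on $\mathbb{R}^n$ and $|\cdot|$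 the Euclidean norm; $B_E(p,r)$ is the closed Euclidean ball of center $p$ and radius $r$. The homogeneous metric $d_\infty$ is $$d_\infty(p,q)=\max\{|p^1-q^1|,\;c\,|p^2-q^2+P(p^1,q^1)|^{1/2}\},$$ where $c\in(0,1)$ is a suitable fixed constant, depending only on the group structure, for which $d_\infty$ is a metric (it is then left-invariant and one-homogeneous with respect to the dilations $\delta_\lambda(p)=[\lambda p^1,\lambda^2p^2]$). Horizontal planes. For $p\in\mathbb{G}$, $V(p)$ is the left translate by $p$ of $\{[q^1,0]:q^1\in\mathbb{R}^{m_1}\}$, i.e. $V(p)=\{[q^1,q^2]: q^2=p^2+P(p^1,q^1)\}$. For $\delta>0$, $V(p)(\delta)$ is the set of $q\in\mathbb{G}$ whose Euclidean distance from $V(p)$ is $\le\delta$. Hausdorff measures. For a metric $d$ and $0<s<\infty$, $\mathcal{H}^s(A)=\lim_{\delta\to0}\mathcal{H}^s_\delta(A)$ with $\mathcal{H}^s_\delta(A)=\inf\{\sum_{j=1}^\infty\operatorname{diam}_d(A_j)^s: A\subset\bigcup_j A_j,\ \operatorname{diam}_d(A_j)<\delta\}$ (no normalizing constant). $\mathcal{H}^s_E$ and $\mathcal{H}^s_{\mathbb{G}}$ denote the $s$-dimensional Hausdorff (outer) measures with respect to $d_E$ and $d_\infty$ respectively. *)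

theory Defs
  imports "HOL-Analysis.Analysis"
begin

definition ediam :: "('a \<Rightarrow> 'a \<Rightarrow> real) \<Rightarrow> 'a set \<Rightarrow> ennreal" where
  "ediam d S = (SUP x\<in>S. SUP y\<in>S. ennreal (d x y))"

text \<open>The diameters occurring in an admissible cover are smaller than a real number, hence finite,
  so that \<^const>\<open>enn2real\<close> loses nothing. The exponent is meant to be positive; then empty sets
  and singletons contribute \<open>0 powr s = 0\<close>.\<close>

definition hausdorff_pre :: "('a \<Rightarrow> 'a \<Rightarrow> real) \<Rightarrow> real \<Rightarrow> real \<Rightarrow> 'a set \<Rightarrow> ennreal" where
  "hausdorff_pre d s \<delta> A =
     Inf {(\<Sum>j. ennreal (enn2real (ediam d (C j)) powr s)) | C :: nat \<Rightarrow> 'a set.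
            A \<subseteq> (\<Union>j. C j) \<and> (\<forall>j. ediam d (C j) < ennreal \<delta>)}"

definition hausdorff_measure :: "('a \<Rightarrow> 'a \<Rightarrow> real) \<Rightarrow> real \<Rightarrow> 'a set \<Rightarrow> ennreal" where
  "hausdorff_measure d s A = Lim (at_right 0) (\<lambda>\<delta>. hausdorff_pre d s \<delta> A)"

lemma hausdorff_pre_antimono:
  assumes "\<delta> \<le> \<epsilon>"
  shows "hausdorff_pre d s \<epsilon> A \<le> hausdorff_pre d s \<delta> A"
proof -
  have *: "x < ennreal \<epsilon>" if "x < ennreal \<delta>" for x
    using that ennreal_leI[OF assms] by (rule less_le_trans)
  show ?thesis
    unfolding hausdorff_pre_def
    by (rule Inf_superset_mono, rule Collect_mono) (auto intro: *)
qed

lemma tendsto_hausdorff_pre: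
  "((\<lambda>\<delta>. hausdorff_pre d s \<delta> A) \<longlongrightarrow> (SUP \<delta>\<in>{0<..}. hausdorff_pre d s \<delta> A)) (at_right 0)"
proof (rule order_tendstoI)
  fix a assume "a < (SUP \<delta>\<in>{0<..}. hausdorff_pre d s \<delta> A)"
  then obtain \<delta> where \<delta>: "\<delta> > 0" "a < hausdorff_pre d s \<delta> A"
    unfolding less_SUP_iff by auto
  have "a < hausdorff_pre d s x A" if "x < \<delta>" for x
    using \<delta>(2) hausdorff_pre_antimono[OF less_imp_le[OF that]] by (rule less_le_trans)
  then show "\<forall>\<^sub>F x in at_right 0. a < hausdorff_pre d s x A"
    unfolding eventually_at_right_field using \<delta>(1) by (intro exI[of _ \<delta>]) simp
next
  fix a assume a: "(SUP \<delta>\<in>{0<..}. hausdorff_pre d s \<delta> A) < a"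
  have "hausdorff_pre d s x A < a" if "0 < x" for x
    by (rule le_less_trans[OF SUP_upper a]) (simp add: that)
  then show "\<forall>\<^sub>F x in at_right 0. hausdorff_pre d s x A < a"
    unfolding eventually_at_right_field by (intro exI[of _ 1]) simp
qed

lemma hausdorff_measure_eq_SUP:
  "hausdorff_measure d s A = (SUP \<delta>\<in>{0<..}. hausdorff_pre d s \<delta> A)"
  unfolding hausdorff_measure_def
  by (rule tendsto_Lim[OF _ tendsto_hausdorff_pre]) simp

text \<open>The group is \<open>real ^ 'm \<times> real ^ 'k\<close>, whose product metric \<^const>\<open>dist\<close> and norm are the
  Euclidean ones. The structure constant \<open>b\<^sup>j\<^sub>l\<^sub>,\<^sub>i\<close> is \<open>b j l i\<close>; only the values with \<open>l < i\<close>
  matter, which is why the index type of the first layer is linearly ordered.\<close>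

type_synonym ('m, 'k) str = "'k \<Rightarrow> 'm \<Rightarrow> 'm \<Rightarrow> real"
type_synonym ('m, 'k) pt = "(real ^ 'm) \<times> (real ^ 'k)"

definition carnot_P ::
  "('m::{finite,linorder}, 'k::finite) str \<Rightarrow>
     (real, 'm) vec \<Rightarrow> (real, 'm) vec \<Rightarrow> (real, 'k) vec" where
  "carnot_P b x y =
     (\<chi> j. \<Sum>(l, i)\<in>{(l, i). l < i}. b j l i * (x $ l * y $ i - x $ i * y $ l))"

definition carnot_mult ::
  "('m::{finite,linorder}, 'k::finite) str \<Rightarrow> ('m, 'k) pt \<Rightarrow> ('m, 'k) pt \<Rightarrow> ('m, 'k) pt" where
  "carnot_mult b p q = (fst p + fst q, snd p + snd q + carnot_P b (fst p) (fst q))"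

text \<open>The Lie bracket belonging to the group law: in exponential coordinates of a step 2 group,
  the Baker--Campbell--Hausdorff formula reads \<open>X \<cdot> Y = X + Y + [X, Y] / 2\<close>.\<close>

definition lie_bracket ::
  "('m::{finite,linorder}, 'k::finite) str \<Rightarrow> ('m, 'k) pt \<Rightarrow> ('m, 'k) pt \<Rightarrow> ('m, 'k) pt" where
  "lie_bracket b X Y = (0, 2 *\<^sub>R carnot_P b (fst X) (fst Y))"

lemma carnot_mult_BCH: "carnot_mult b X Y = X + Y + (1 / 2) *\<^sub>R lie_bracket b X Y"
  by (simp add: carnot_mult_def lie_bracket_def prod_eq_iff)

definition lie_bracket_span ::
  "('m::{finite,linorder}, 'k::finite) str \<Rightarrow> ('m, 'k) pt set \<Rightarrow> ('m, 'k) pt set \<Rightarrow> ('m, 'k) pt set"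
  where "lie_bracket_span b U W = span {lie_bracket b X Y | X Y. X \<in> U \<and> Y \<in> W}"

definition layer1 :: "('m::finite, 'k::finite) pt set" where
  "layer1 = {(x, 0) | x. True}"

definition layer2 :: "('m::finite, 'k::finite) pt set" where
  "layer2 = {(0, t) | t. True}"

definition carnot_step2 :: "('m::{finite,linorder}, 'k::finite) str \<Rightarrow> bool" where
  "carnot_step2 b \<longleftrightarrow>
     lie_bracket_span b layer1 layer1 = layer2 \<and> layer2 \<noteq> ({0} :: ('m, 'k) pt set) \<and>
     lie_bracket_span b layer1 layer2 = {0}"

definition d_inf ::
  "('m::{finite,linorder}, 'k::finite) str \<Rightarrow> real \<Rightarrow> ('m, 'k) pt \<Rightarrow> ('m, 'k) pt \<Rightarrow> real" where
  "d_inf b c p q =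
     max (norm (fst p - fst q)) (c * sqrt (norm (snd p - snd q + carnot_P b (fst p) (fst q))))"

definition hplane ::
  "('m::{finite,linorder}, 'k::finite) str \<Rightarrow> ('m, 'k) pt \<Rightarrow> ('m, 'k) pt set" where
  "hplane b p = carnot_mult b p ` layer1"

definition hplane_nbhd ::
  "('m::{finite,linorder}, 'k::finite) str \<Rightarrow> ('m, 'k) pt \<Rightarrow> real \<Rightarrow> ('m, 'k) pt set" where
  "hplane_nbhd b p \<delta> = {q. infdist q (hplane b p) \<le> \<delta>}"

lemma carnot_P_add_left: "carnot_P b (x + x') y = carnot_P b x y + carnot_P b x' y"
  by (simp add: carnot_P_def vec_eq_iff flip: sum.distrib)
    (auto intro!: sum.cong simp: algebra_simps)

lemma carnot_P_scaleR_left: "carnot_P b (r *\<^sub>R x) y = r *\<^sub>R carnot_P b x y"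
  by (simp add: carnot_P_def vec_eq_iff sum_distrib_left)
    (auto intro!: sum.cong simp: algebra_simps)

lemma carnot_P_swap: "carnot_P b y x = - carnot_P b x y"
  unfolding carnot_P_def vec_eq_iff vector_uminus_component vec_lambda_beta sum_negf[symmetric]
  by (auto intro!: sum.cong simp: algebra_simps)

lemma carnot_P_self [simp]: "carnot_P b x x = 0"
  by (simp add: carnot_P_def vec_eq_iff mult.commute)

lemma carnot_P_add_right: "carnot_P b x (y + y') = carnot_P b x y + carnot_P b x y'"
  by (simp add: carnot_P_def vec_eq_iff flip: sum.distrib)
    (auto intro!: sum.cong simp: algebra_simps)

lemma carnot_P_scaleR_right: "carnot_P b x (r *\<^sub>R y) = r *\<^sub>R carnot_P b x y"
  by (simp add: carnot_P_def vec_eq_iff sum_distrib_left)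
    (auto intro!: sum.cong simp: algebra_simps)

lemma bilinear_carnot_P: "bilinear (carnot_P b)"
  unfolding bilinear_def
  by (auto intro!: linearI simp: carnot_P_add_left carnot_P_add_right
      carnot_P_scaleR_left carnot_P_scaleR_right)

lemma hplane_eq: "hplane b p = {(q1, q2). q2 = snd p + carnot_P b (fst p) q1}"
proof (intro equalityI subsetI)
  fix q assume "q \<in> hplane b p"
  then show "q \<in> {(q1, q2). q2 = snd p + carnot_P b (fst p) q1}"
    by (auto simp: hplane_def carnot_mult_def layer1_def carnot_P_add_right)
next
  fix q assume "q \<in> {(q1, q2). q2 = snd p + carnot_P b (fst p) q1}"
  then have "q = carnot_mult b p (fst q - fst p, 0)"
    using carnot_P_add_right[of b "fst p" "fst q - fst p" "fst p"]
    by (auto simp: carnot_mult_def)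
  then show "q \<in> hplane b p"
    unfolding hplane_def layer1_def by blast
qed

lemma ex_Metric_space_d_inf: "\<exists>c. 0 < c \<and> c < 1 \<and> Metric_space UNIV (d_inf b c)"
proof -
  obtain K where K: "K > 0" "\<And>x y. norm (carnot_P b x y) \<le> K * norm x * norm y"
    using bilinear_bounded_pos[OF bilinear_carnot_P] by metis
  define c where "c = 1 / sqrt (K + 2)"
  have c: "0 < c" "c < 1" and c2: "c\<^sup>2 * K \<le> 1"
    using K(1) by (auto simp: c_def power_divide field_simps)
  have "Metric_space UNIV (d_inf b c)"
  proof
    fix p q r :: "('a, 'b) pt"
    show "0 \<le> d_inf b c p q" by (simp add: d_inf_def le_max_iff_disj)
    have "snd q - snd p + carnot_P b (fst q) (fst p)
        = - (snd p - snd q + carnot_P b (fst p) (fst q))"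
      by (simp add: carnot_P_swap[of b "fst p" "fst q"])
    then show "d_inf b c p q = d_inf b c q p"
      by (simp only: d_inf_def norm_minus_cancel norm_minus_commute[of "fst p"])
    show "d_inf b c p q = 0 \<longleftrightarrow> p = q"
    proof
      assume d0: "d_inf b c p q = 0"
      have "norm (fst p - fst q) \<le> d_inf b c p q"
        and "c * sqrt (norm (snd p - snd q + carnot_P b (fst p) (fst q))) \<le> d_inf b c p q"
        by (auto simp: d_inf_def)
      with d0 c(1) have e: "fst p = fst q" and "snd p - snd q + carnot_P b (fst p) (fst q) = 0"
        by (auto simp: mult_le_0_iff)
      then show "p = q" by (simp add: prod_eq_iff)
    qed (auto simp: d_inf_def)
    define T where "T p q = snd p - snd q + carnot_P b (fst p) (fst q)" for p q :: "('a, 'b) pt"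
    define M where "M = d_inf b c p q"
    define N where "N = d_inf b c q r"
    have T_le: "c\<^sup>2 * norm (T u v) \<le> (d_inf b c u v)\<^sup>2" for u v
    proof -
      have "(c * sqrt (norm (T u v)))\<^sup>2 \<le> (d_inf b c u v)\<^sup>2"
        by (rule power_mono) (use c in \<open>auto simp: d_inf_def T_def\<close>)
      then show ?thesis by (simp add: power_mult_distrib)
    qed
    have MN: "M \<ge> 0" "N \<ge> 0" by (auto simp: M_def N_def d_inf_def le_max_iff_disj)
    have fM: "norm (fst p - fst q) \<le> M" and fN: "norm (fst q - fst r) \<le> N"
      by (auto simp: M_def N_def d_inf_def)
    have expand: "carnot_P b (fst p - fst q) (fst q - fst r)
        = carnot_P b (fst p) (fst q) - carnot_P b (fst p) (fst r) + carnot_P b (fst q) (fst r)"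
      using bilinear_carnot_P[of b] by (simp add: bilinear_lsub bilinear_rsub)
    have "T p r = T p q + T q r - carnot_P b (fst p - fst q) (fst q - fst r)"
      unfolding T_def expand by simp
    then have "norm (T p r)
        = norm (T p q + T q r - carnot_P b (fst p - fst q) (fst q - fst r))" by simp
    then have "norm (T p r) \<le> norm (T p q) + norm (T q r)
        + norm (carnot_P b (fst p - fst q) (fst q - fst r))"
      using norm_triangle_ineq4[of "T p q + T q r"
          "carnot_P b (fst p - fst q) (fst q - fst r)"] norm_triangle_ineq[of "T p q" "T q r"]
      by linarith
    also have "norm (carnot_P b (fst p - fst q) (fst q - fst r)) \<le> K * M * N"
    proof -
      have "K * norm (fst p - fst q) * norm (fst q - fst r) \<le> K * M * N"
        using K(1) fM fN MN by (intro mult_mono) auto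
      then show ?thesis using K(2) order_trans by blast
    qed
    finally have "c\<^sup>2 * norm (T p r) \<le> c\<^sup>2 * (norm (T p q) + norm (T q r) + K * M * N)"
      by (intro mult_left_mono) auto
    also have "\<dots> = c\<^sup>2 * norm (T p q) + c\<^sup>2 * norm (T q r) + c\<^sup>2 * K * (M * N)"
      by (simp add: algebra_simps)
    also have "\<dots> \<le> M\<^sup>2 + N\<^sup>2 + 1 * (M * N)"
      unfolding M_def N_def
      by (intro add_mono mult_right_mono T_le c2) (use MN in \<open>auto simp: M_def N_def\<close>)
    also have "\<dots> \<le> (M + N)\<^sup>2"
      using MN by (simp add: power2_sum)
    finally have "(c * sqrt (norm (T p r)))\<^sup>2 \<le> (M + N)\<^sup>2"
      by (simp add: power_mult_distrib)
    then have "c * sqrt (norm (T p r)) \<le> M + N"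
      by (rule power2_le_imp_le) (use MN in auto)
    moreover have "norm (fst p - fst r) \<le> M + N"
      using norm_triangle_ineq[of "fst p - fst q" "fst q - fst r"] fM fN by simp
    ultimately show "d_inf b c p r \<le> d_inf b c p q + d_inf b c q r"
      by (simp add: d_inf_def[of b c p r] T_def M_def N_def)
  qed
  with c show ?thesis by blast
qed

end

theory Submission
  imports Defs
begin

text \<open>Write \<open>\<mu>\<close> for the Euclidean \<open>s\<close>-dimensional measure and \<open>k\<close> for the dimension of the second
  layer. The part of a Euclidean ball of radius \<open>r\<close> around \<open>p\<close> that lies within vertical distance
  \<open>l r\<close> of the horizontal plane at \<open>p\<close> is covered by about \<open>(l / r)\<^sup>k\<close> sets of homogeneous diameter
  about \<open>r\<close>, so it contributes at most \<open>C l\<^sup>k r\<^sup>s\<close> in dimension \<open>s + k\<close>. Let \<open>F\<close> be a set of points at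
  which the conclusion fails, uniformly for all radii below some \<open>r0\<close>. Cover \<open>F\<close> by balls centred
  in \<open>F\<close> with \<open>\<Sum> r\<^sub>j\<^sup>s\<close> close to \<open>\<mu> F\<close>. What is left of \<open>F\<close> outside the slabs has measure at most
  \<open>\<theta> \<mu> F\<close> with \<open>\<theta> < 1\<close>: here the bound \<open>2\<^sup>-\<^sup>s\<^sup>-\<^sup>1 < 2\<^sup>-\<^sup>s\<close> is used. Iterating on what is left, a geometric
  series bounds the homogeneous measure of \<open>F\<close> by a multiple of \<open>l\<^sup>k \<mu> F\<close>. The uniformity is
  achieved on countably many pieces, whose measures add up because the pieces are cut out by
  closed sets. Finally let \<open>l\<close> tend to \<open>0\<close>.\<close>

section \<open>Hausdorff measures\<close>

lemma ediam_empty [simp]: "ediam d {} = 0"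
  by (simp add: ediam_def bot_ennreal)

lemma ediam_mono: "S \<subseteq> T \<Longrightarrow> ediam d S \<le> ediam d T"
  unfolding ediam_def by (intro SUP_subset_mono order_refl)

lemma hausdorff_pre_le:
  assumes "A \<subseteq> (\<Union>j. C j)" "\<And>j. ediam d (C j) < ennreal \<delta>"
  shows "hausdorff_pre d s \<delta> A \<le> (\<Sum>j. ennreal (enn2real (ediam d (C j)) powr s))"
  unfolding hausdorff_pre_def using assms by (intro Inf_lower) blast

lemma hausdorff_pre_less_iff:
  "hausdorff_pre d s \<delta> A < x \<longleftrightarrow>
    (\<exists>C. A \<subseteq> (\<Union>j. C j) \<and> (\<forall>j. ediam d (C j) < ennreal \<delta>) \<and>
       (\<Sum>j. ennreal (enn2real (ediam d (C j)) powr s)) < x)"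
  unfolding hausdorff_pre_def Inf_less_iff by blast

lemma hausdorff_pre_mono: "A \<subseteq> B \<Longrightarrow> hausdorff_pre d s \<delta> A \<le> hausdorff_pre d s \<delta> B"
  unfolding hausdorff_pre_def by (rule Inf_superset_mono) blast

lemma hausdorff_pre_le_single:
  assumes "0 \<le> D" "\<And>x y. x \<in> A \<Longrightarrow> y \<in> A \<Longrightarrow> d x y \<le> D" "D < \<delta>" "0 < \<delta>" "0 \<le> s"
  shows "hausdorff_pre d s \<delta> A \<le> ennreal (D powr s)"
proof (cases "A = {}")
  case True
  have "hausdorff_pre d s \<delta> A \<le> (\<Sum>j. ennreal (enn2real (ediam d {}) powr s))"
    by (rule hausdorff_pre_le[where C = "\<lambda>_. {}"]) (use True assms in auto)
  then show ?thesis by simp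
next
  case False
  have D: "0 \<le> D" by (rule assms)
  define C where "C j = (if j = 0 then A else {})" for j :: nat
  have A: "ediam d A \<le> ennreal D"
    unfolding ediam_def by (intro SUP_least ennreal_leI assms)
  also have "ennreal D < ennreal \<delta>" using D assms by (simp add: ennreal_less_iff)
  finally have "hausdorff_pre d s \<delta> A \<le> (\<Sum>j. ennreal (enn2real (ediam d (C j)) powr s))"
    using assms by (intro hausdorff_pre_le) (auto simp: C_def)
  also have "\<dots> = (\<Sum>j\<in>{0}. ennreal (enn2real (ediam d (C j)) powr s))"
    by (rule suminf_finite) (auto simp: C_def)
  also have "\<dots> \<le> ennreal (D powr s)"
    using A D assms by (auto simp: C_def intro!: ennreal_leI powr_mono2 enn2real_leI)
  finally show ?thesis .
qed

lemma hausdorff_pre_empty [simp]: "0 < \<delta> \<Longrightarrow> hausdorff_pre d s \<delta> {} = 0"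
  using hausdorff_pre_le[of "{}" "\<lambda>_. {}" d \<delta> s] by simp

lemma hausdorff_pre_UN_le:
  "hausdorff_pre d s \<delta> (\<Union>i::nat. A i) \<le> (\<Sum>i. hausdorff_pre d s \<delta> (A i))"
proof (rule ennreal_le_epsilon)
  fix e :: real
  assume fin: "(\<Sum>i. hausdorff_pre d s \<delta> (A i)) < top" and e: "0 < e"
  \<comment> \<open>Finiteness of the whole sum makes each summand finite, so that adding a positive
    amount is a strict increase and near-optimal covers exist.\<close>
  have "hausdorff_pre d s \<delta> (A i) < hausdorff_pre d s \<delta> (A i) + ennreal (e * (1/2) ^ Suc i)" for i
  proof -
    have "hausdorff_pre d s \<delta> (A i) \<le> (\<Sum>i. hausdorff_pre d s \<delta> (A i))"
      using sum_le_suminf[OF summableI, of "{i}" "\<lambda>i. hausdorff_pre d s \<delta> (A i)"] by simp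
    then have "hausdorff_pre d s \<delta> (A i) < top" using fin by (rule le_less_trans)
    then show ?thesis using e ennreal_add_left_cancel_less[of "hausdorff_pre d s \<delta> (A i)" 0] by simp
  qed
  then obtain C where C: "\<And>i. A i \<subseteq> (\<Union>j. C i j)" "\<And>i j. ediam d (C i j) < ennreal \<delta>"
    "\<And>i. (\<Sum>j. ennreal (enn2real (ediam d (C i j)) powr s))
            < hausdorff_pre d s \<delta> (A i) + ennreal (e * (1/2) ^ Suc i)"
    unfolding hausdorff_pre_less_iff by metis
  define C' where "C' n = (case prod_decode n of (i, j) \<Rightarrow> C i j)" for n
  have "hausdorff_pre d s \<delta> (\<Union>i. A i) \<le> (\<Sum>n. ennreal (enn2real (ediam d (C' n)) powr s))"
  proof (rule hausdorff_pre_le)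
    show "(\<Union>i. A i) \<subseteq> (\<Union>n. C' n)"
    proof
      fix x assume "x \<in> (\<Union>i. A i)"
      then obtain i j where "x \<in> C i j" using C(1) by blast
      then have "x \<in> C' (prod_encode (i, j))" by (simp add: C'_def)
      then show "x \<in> (\<Union>n. C' n)" by blast
    qed
  qed (use C in \<open>auto simp: C'_def split: prod.split\<close>)
  also have "\<dots> = (\<Sum>n. (\<lambda>(i, j). ennreal (enn2real (ediam d (C i j)) powr s)) (prod_decode n))"
    by (simp add: C'_def split_beta)
  also have "\<dots> = (\<Sum>i. \<Sum>j. ennreal (enn2real (ediam d (C i j)) powr s))"
    by (rule suminf_ennreal_2dimen) simp
  also have "\<dots> \<le> (\<Sum>i. hausdorff_pre d s \<delta> (A i) + ennreal (e * (1/2) ^ Suc i))"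
    by (intro suminf_le summableI less_imp_le C)
  also have "\<dots> = (\<Sum>i. hausdorff_pre d s \<delta> (A i)) + (\<Sum>i. ennreal (e * (1/2) ^ Suc i))"
    by (rule suminf_add[symmetric]) (rule summableI)+
  also have "(\<Sum>i. ennreal (e * (1/2) ^ Suc i)) = ennreal e"
    using sums_mult[OF power_half_series, of e] e
    by (intro suminf_ennreal_eq) auto
  finally show "hausdorff_pre d s \<delta> (\<Union>i. A i) \<le> (\<Sum>i. hausdorff_pre d s \<delta> (A i)) + ennreal e" .
qed

lemma hausdorff_pre_UN_finite_le:
  assumes "finite I" "0 < \<delta>"
  shows "hausdorff_pre d s \<delta> (\<Union>i\<in>I. A i) \<le> (\<Sum>i\<in>I. hausdorff_pre d s \<delta> (A i))"
  using assms(1)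
proof (induction I rule: finite_induct)
  case (insert i I)
  define B where "B j = (if j = 0 then A i else if j = 1 then (\<Union>i\<in>I. A i) else {})" for j :: nat
  have "(\<Union>i\<in>insert i I. A i) = (\<Union>j. B j)"
    by (auto simp: B_def split: if_splits)
  then have "hausdorff_pre d s \<delta> (\<Union>i\<in>insert i I. A i) \<le> (\<Sum>j. hausdorff_pre d s \<delta> (B j))"
    by (simp only: hausdorff_pre_UN_le)
  also have "\<dots> = (\<Sum>j\<in>{0,1}. hausdorff_pre d s \<delta> (B j))"
    using assms(2) by (intro suminf_finite) (auto simp: B_def)
  also have "\<dots> \<le> (\<Sum>i\<in>insert i I. hausdorff_pre d s \<delta> (A i))"
    using insert by (simp add: B_def add_left_mono)
  finally show ?case .
qed (use assms in simp)

lemma hausdorff_pre_Un_le: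
  assumes "0 < \<delta>"
  shows "hausdorff_pre d s \<delta> (A \<union> B) \<le> hausdorff_pre d s \<delta> A + hausdorff_pre d s \<delta> B"
  using hausdorff_pre_UN_finite_le[OF _ assms, of "UNIV::bool set" d s "\<lambda>b. if b then A else B"]
  by (simp add: UNIV_bool Un_commute add.commute)

lemma hausdorff_pre_le_measure: "0 < \<delta> \<Longrightarrow> hausdorff_pre d s \<delta> A \<le> hausdorff_measure d s A"
  unfolding hausdorff_measure_eq_SUP by (rule SUP_upper) simp

lemma hausdorff_measure_leI:
  "(\<And>\<delta>. 0 < \<delta> \<Longrightarrow> hausdorff_pre d s \<delta> A \<le> x) \<Longrightarrow> hausdorff_measure d s A \<le> x"
  unfolding hausdorff_measure_eq_SUP by (rule SUP_least) simp

lemma hausdorff_measure_mono: "A \<subseteq> B \<Longrightarrow> hausdorff_measure d s A \<le> hausdorff_measure d s B"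
  unfolding hausdorff_measure_eq_SUP by (intro SUP_mono' hausdorff_pre_mono)

lemma hausdorff_measure_empty [simp]: "hausdorff_measure d s {} = 0"
  using hausdorff_measure_leI[of d s "{}" 0] by simp

lemma hausdorff_measure_UN_le:
  "hausdorff_measure d s (\<Union>i::nat. A i) \<le> (\<Sum>i. hausdorff_measure d s (A i))"
proof (rule hausdorff_measure_leI)
  fix \<delta> :: real assume "0 < \<delta>"
  then have "(\<Sum>i. hausdorff_pre d s \<delta> (A i)) \<le> (\<Sum>i. hausdorff_measure d s (A i))"
    by (intro suminf_le summableI hausdorff_pre_le_measure)
  then show "hausdorff_pre d s \<delta> (\<Union>i. A i) \<le> (\<Sum>i. hausdorff_measure d s (A i))"
    using hausdorff_pre_UN_le order_trans by blast
qed

lemma hausdorff_measure_Un_le: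
  "hausdorff_measure d s (A \<union> B) \<le> hausdorff_measure d s A + hausdorff_measure d s B"
proof (rule hausdorff_measure_leI)
  fix \<delta> :: real assume \<delta>: "0 < \<delta>"
  show "hausdorff_pre d s \<delta> (A \<union> B) \<le> hausdorff_measure d s A + hausdorff_measure d s B"
    by (rule order_trans[OF hausdorff_pre_Un_le[OF \<delta>]]) (intro add_mono hausdorff_pre_le_measure \<delta>)
qed

section \<open>Efficient covers by balls centred in the set\<close>

text \<open>A set of diameter \<open>D\<close> lies in the ball of any radius above \<open>D\<close>
  about each of its points, so centring the balls in \<open>E\<close> costs no constant factor. For
  \<open>s\<close> at least 1, a loss of \<open>2 powr s\<close> here would destroy the contraction
  by \<open>3 / 4\<close> in the iteration.\<close>

lemma hausdorff_pre_ball_cover: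
  fixes E :: "'a::metric_space set"
  assumes "hausdorff_pre dist s \<eta> E < ennreal M" "0 < \<eta>" "E \<noteq> {}" "0 < s"
  obtains p r where "\<And>j::nat. p j \<in> E" "\<And>j. 0 < r j" "\<And>j. r j < \<eta>" "E \<subseteq> (\<Union>j. cball (p j) (r j))"
    "(\<Sum>j. ennreal (r j powr s)) < ennreal M"
proof -
  obtain C where C: "E \<subseteq> (\<Union>j. C j)" "\<And>j. ediam dist (C j) < ennreal \<eta>"
    and sum: "(\<Sum>j. ennreal (enn2real (ediam dist (C j)) powr s)) < ennreal M"
    using assms(1) unfolding hausdorff_pre_less_iff by blast
  define D where "D j = enn2real (ediam dist (C j))" for j
  have eD: "ediam dist (C j) = ennreal (D j)" for j
    using order.strict_trans[OF C(2)[of j] ennreal_less_top] by (simp add: D_def)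
  have D: "0 \<le> D j" "D j < \<eta>" for j
    using C(2)[of j, unfolded eD] by (auto simp: D_def ennreal_less_iff)
  define S where "S = enn2real (\<Sum>j. ennreal (D j powr s))"
  have "(\<Sum>j. ennreal (D j powr s)) < top"
    using order.strict_trans[OF sum ennreal_less_top] unfolding D_def .
  then have S: "(\<Sum>j. ennreal (D j powr s)) = ennreal S" "0 \<le> S"
    by (simp_all add: S_def)
  have "S < M"
    using sum S unfolding D_def[symmetric] by (simp only: ennreal_less_iff)
  define e where "e = (M - S) / 2"
  have e: "0 < e" "S + e < M" using \<open>S < M\<close> by (auto simp: e_def field_simps)
  define e' where "e' j = e * (1/2) ^ Suc j" for j
  have e': "0 < e' j" for j using e by (simp add: e'_def)
  \<comment> \<open>Both terms exceed \<open>D j\<close>: the first limits the increase of the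
    \<open>s\<close>-th power to \<open>e' j\<close>, the second keeps the radius below
    \<open>\<eta>\<close>. The radius is positive even where \<open>D j = 0\<close>.\<close>
  define r where "r j = min ((D j powr s + e' j) powr (1 / s)) ((D j + \<eta>) / 2)" for j
  have Dr: "D j < r j" for j
  proof -
    have "(D j powr s) powr (1 / s) < (D j powr s + e' j) powr (1 / s)"
      using assms(4) e'[of j] by (intro powr_less_mono2) auto
    then show ?thesis using D[of j] assms(4) by (simp add: r_def powr_powr)
  qed
  have r0: "0 < r j" for j using Dr[of j] D[of j] by simp
  have rs: "r j powr s \<le> D j powr s + e' j" for j
  proof -
    have "r j powr s \<le> ((D j powr s + e' j) powr (1 / s)) powr s"
      using r0[of j] assms(4) by (intro powr_mono2) (auto simp: r_def)
    also have "\<dots> = D j powr s + e' j"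
      using assms(4) e'[of j] by (simp add: powr_powr)
    finally show ?thesis .
  qed
  \<comment> \<open>If \<open>C j\<close> misses \<open>E\<close>, nothing has to be covered and any
    centre in \<open>E\<close> serves.\<close>
  have "\<exists>p. p \<in> E \<and> E \<inter> C j \<subseteq> cball p (r j)" for j
  proof (cases "E \<inter> C j = {}")
    case True
    then show ?thesis using assms(3) by auto
  next
    case False
    then obtain p where p: "p \<in> E" "p \<in> C j" by blast
    have "dist p q \<le> r j" if "q \<in> C j" for q
    proof -
      have "ennreal (dist p q) \<le> ediam dist (C j)"
        unfolding ediam_def by (rule SUP_upper2[OF p(2)], rule SUP_upper, rule that)
      then show ?thesis using D(1)[of j] Dr[of j] by (simp add: eD)
    qed
    then show ?thesis using p by auto
  qed
  then obtain p where p: "\<And>j. p j \<in> E" "\<And>j. E \<inter> C j \<subseteq> cball (p j) (r j)" by metis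
  show thesis
  proof (rule that[of p r])
    show "E \<subseteq> (\<Union>j. cball (p j) (r j))" using C(1) p(2) by blast
    have "(\<Sum>j. ennreal (r j powr s)) \<le> (\<Sum>j. ennreal (D j powr s) + ennreal (e' j))"
      using rs e' by (intro suminf_le summableI) (simp add: less_imp_le flip: ennreal_plus)
    also have "\<dots> = (\<Sum>j. ennreal (D j powr s)) + (\<Sum>j. ennreal (e' j))"
      by (rule suminf_add[symmetric]) (rule summableI)+
    also have "(\<Sum>j. ennreal (e' j)) = ennreal e"
      using sums_mult[OF power_half_series, of e] e unfolding e'_def
      by (intro suminf_ennreal_eq) auto
    also have "(\<Sum>j. ennreal (D j powr s)) + ennreal e < ennreal M"
      using S(2) e unfolding S(1) by (simp add: ennreal_less_iff flip: ennreal_plus)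
    finally show "(\<Sum>j. ennreal (r j powr s)) < ennreal M" .
    show "r j < \<eta>" for j using D(2)[of j] by (simp add: r_def min_def)
  qed (use p r0 in auto)
qed

section \<open>Additivity of the Euclidean measure across closed sets\<close>

text \<open>A set of diameter below \<open>\<delta>\<close> cannot meet both \<open>X\<close> and
  \<open>Y\<close>, so intersecting a cover of the union with \<open>X\<close> and with
  \<open>Y\<close> gives two covers that charge each member at most once.\<close>

lemma hausdorff_pre_separated:
  fixes X Y :: "'a::metric_space set"
  assumes sep: "\<And>x y. x \<in> X \<Longrightarrow> y \<in> Y \<Longrightarrow> \<delta> \<le> dist x y" and "0 < s"
  shows "hausdorff_pre dist s \<delta> X + hausdorff_pre dist s \<delta> Y \<le> hausdorff_pre dist s \<delta> (X \<union> Y)"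
proof -
  have "hausdorff_pre dist s \<delta> X + hausdorff_pre dist s \<delta> Y
      \<le> (\<Sum>j. ennreal (enn2real (ediam dist (C j)) powr s))"
    if C: "X \<union> Y \<subseteq> (\<Union>j. C j)" "\<And>j. ediam dist (C j) < ennreal \<delta>" for C :: "nat \<Rightarrow> 'a set"
  proof -
    define w where "w S = ennreal (enn2real (ediam dist S) powr s)" for S :: "'a set"
    have small: "ediam dist (C j \<inter> Z) < ennreal \<delta>" for j Z
      by (rule le_less_trans[OF ediam_mono C(2)]) blast
    have pre_le: "hausdorff_pre dist s \<delta> Z \<le> (\<Sum>j. w (C j \<inter> Z))" if "Z \<subseteq> X \<union> Y" for Z
      unfolding w_def by (rule hausdorff_pre_le) (use C(1) that small in auto)
    have w_mono: "w (C j \<inter> Z) \<le> w (C j)" for j Z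
      unfolding w_def using order.strict_trans[OF C(2)[of j] ennreal_less_top] \<open>0 < s\<close>
      by (intro ennreal_leI powr_mono2 enn2real_mono ediam_mono) auto
    have "w (C j \<inter> X) + w (C j \<inter> Y) \<le> w (C j)" for j
    proof -
      have "C j \<inter> X = {} \<or> C j \<inter> Y = {}"
      proof (rule ccontr)
        assume "\<not> ?thesis"
        then obtain x y where xy: "x \<in> C j" "x \<in> X" "y \<in> C j" "y \<in> Y" by blast
        have "ennreal \<delta> \<le> ennreal (dist x y)" using sep xy by (simp add: ennreal_leI)
        also have "\<dots> \<le> ediam dist (C j)"
          unfolding ediam_def by (rule SUP_upper2[OF xy(1)], rule SUP_upper, rule xy(3))
        finally show False using C(2)[of j] by simp
      qed
      then show ?thesis using w_mono[of j X] w_mono[of j Y] by (auto simp: w_def)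
    qed
    then have "(\<Sum>j. w (C j \<inter> X)) + (\<Sum>j. w (C j \<inter> Y)) \<le> (\<Sum>j. w (C j))"
      by (subst suminf_add) (auto intro!: suminf_le summableI)
    with add_mono[OF pre_le[OF Un_upper1] pre_le[OF Un_upper2]] show ?thesis
      unfolding w_def by (rule order_trans)
  qed
  then show ?thesis
    unfolding hausdorff_pre_def[of _ _ _ "X \<union> Y"] by (intro Inf_greatest) blast
qed

lemma hausdorff_measure_separated:
  fixes X Y :: "'a::metric_space set"
  assumes sep: "\<And>x y. x \<in> X \<Longrightarrow> y \<in> Y \<Longrightarrow> e \<le> dist x y" and "0 < e" "0 < s"
  shows "hausdorff_measure dist s X + hausdorff_measure dist s Y \<le> hausdorff_measure dist s (X \<union> Y)"
proof (rule tendsto_le)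
  show "((\<lambda>\<delta>. hausdorff_pre dist s \<delta> X + hausdorff_pre dist s \<delta> Y) \<longlongrightarrow>
      hausdorff_measure dist s X + hausdorff_measure dist s Y) (at_right 0)"
    unfolding hausdorff_measure_eq_SUP by (intro tendsto_add tendsto_hausdorff_pre)
  show "((\<lambda>\<delta>. hausdorff_pre dist s \<delta> (X \<union> Y)) \<longlongrightarrow> hausdorff_measure dist s (X \<union> Y)) (at_right 0)"
    unfolding hausdorff_measure_eq_SUP by (rule tendsto_hausdorff_pre)
  show "\<forall>\<^sub>F \<delta> in at_right 0. hausdorff_pre dist s \<delta> X + hausdorff_pre dist s \<delta> Y
      \<le> hausdorff_pre dist s \<delta> (X \<union> Y)"
    unfolding eventually_at_right_field
    using assms by (intro exI[of _ e]) (auto intro!: hausdorff_pre_separated dest: sep)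
qed simp

text \<open>Caratheodory's argument: each annulus \<open>R (i + 1)\<close> around \<open>K\<close> is separated from \<open>U i\<close>, so
  the measures of the annuli form a convergent series with bounded partial sums.\<close>

lemma hausdorff_measure_closed_split:
  fixes K :: "'a::metric_space set"
  assumes "closed K" "0 < s" and fin: "hausdorff_measure dist s E < \<infinity>"
  shows "hausdorff_measure dist s (E \<inter> K) + hausdorff_measure dist s (E - K) \<le> hausdorff_measure dist s E"
proof (cases "K = {}")
  case False
  let ?\<mu> = "hausdorff_measure dist s"
  define U where "U i = {x \<in> E. 1 / real (Suc i) \<le> infdist x K}" for i
  define R where "R i = U (Suc i) - U i" for i
  have mono: "1 / real (Suc (Suc i)) < 1 / real (Suc i)" for i by (simp add: frac_less2)
  have U_mono: "U i \<subseteq> U (Suc i)" for i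
    unfolding U_def using mono[of i] by auto
  have UE: "U i \<subseteq> E" for i by (auto simp: U_def)
  have lip: "infdist x K - infdist y K \<le> dist x y" for x y
    using infdist_triangle[of x K y] by simp
  \<comment> \<open>A point off the closed set \<open>K\<close> has positive distance to it and so
    enters some \<open>U n\<close>; if its first index \<open>m\<close> exceeds \<open>i\<close>, it
    lies in the annulus \<open>R (m - 1)\<close>.\<close>
  have U_lim: "E - K \<subseteq> U i \<union> (\<Union>j. R (i + j))" for i
  proof
    fix x assume x: "x \<in> E - K"
    then have "0 < infdist x K"
      using in_closed_iff_infdist_zero[OF \<open>closed K\<close> False, of x] infdist_nonneg[of x K] by force
    then obtain n where "inverse (real (Suc n)) < infdist x K" using reals_Archimedean by blast
    then have "\<exists>n. x \<in> U n" using x by (auto simp: U_def inverse_eq_divide intro!: exI[of _ n])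
    define m where "m = (LEAST n. x \<in> U n)"
    have m: "x \<in> U m" unfolding m_def using \<open>\<exists>n. x \<in> U n\<close> by (rule LeastI_ex)
    show "x \<in> U i \<union> (\<Union>j. R (i + j))"
    proof (cases "m \<le> i")
      case True
      then show ?thesis using m lift_Suc_mono_le[of U, OF U_mono True] by blast
    next
      case False
      then have "x \<notin> U (m - 1)" unfolding m_def by (intro not_less_Least) (auto simp: m_def)
      then have "x \<in> R (i + (m - 1 - i))" using m False by (auto simp: R_def)
      then show ?thesis by blast
    qed
  qed
  have fin': "?\<mu> X < \<infinity>" if "X \<subseteq> E" for X
    using hausdorff_measure_mono[OF that] fin by (rule le_less_trans)
  have annulus: "?\<mu> (U i) + ?\<mu> (R (Suc i)) \<le> ?\<mu> (U (Suc (Suc i)))" for i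
  proof -
    have "?\<mu> (U i) + ?\<mu> (R (Suc i)) \<le> ?\<mu> (U i \<union> R (Suc i))"
    proof (rule hausdorff_measure_separated)
      fix x y assume "x \<in> U i" "y \<in> R (Suc i)"
      then show "1 / real (Suc i) - 1 / real (Suc (Suc i)) \<le> dist x y"
        using lip[of x y] by (auto simp: R_def U_def)
    qed (use mono[of i] \<open>0 < s\<close> in auto)
    also have "\<dots> \<le> ?\<mu> (U (Suc (Suc i)))"
      using U_mono[of i] U_mono[of "Suc i"] by (intro hausdorff_measure_mono) (auto simp: R_def)
    finally show ?thesis .
  qed
  \<comment> \<open>The estimate \<open>annulus\<close> jumps two indices, so the annuli telescope
    separately for each parity. Carrying \<open>U n\<close> together with \<open>U (Suc n)\<close>
    treats both parities in one induction.\<close>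
  have sum_bd: "(\<Sum>i<n. ?\<mu> (R (Suc i))) + ?\<mu> (U 0) + ?\<mu> (U 1) \<le> ?\<mu> (U n) + ?\<mu> (U (Suc n))" for n
  proof (induction n)
    case (Suc n)
    have "(\<Sum>i<Suc n. ?\<mu> (R (Suc i))) + ?\<mu> (U 0) + ?\<mu> (U 1)
        \<le> ?\<mu> (U n) + ?\<mu> (U (Suc n)) + ?\<mu> (R (Suc n))"
      using add_right_mono[OF Suc, of "?\<mu> (R (Suc n))"] by (simp add: ac_simps)
    also have "\<dots> \<le> ?\<mu> (U (Suc n)) + ?\<mu> (U (Suc (Suc n)))"
      using add_left_mono[OF annulus[of n], of "?\<mu> (U (Suc n))"] by (simp add: ac_simps)
    finally show ?case .
  qed simp
  have "(\<Sum>i<n. ?\<mu> (R (Suc i))) \<le> ?\<mu> E + ?\<mu> E" for n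
  proof -
    have "(\<Sum>i<n. ?\<mu> (R (Suc i))) \<le> (\<Sum>i<n. ?\<mu> (R (Suc i))) + (?\<mu> (U 0) + ?\<mu> (U 1))"
      by simp
    also have "\<dots> \<le> ?\<mu> (U n) + ?\<mu> (U (Suc n))" using sum_bd[of n] by (simp add: ac_simps)
    also have "\<dots> \<le> ?\<mu> E + ?\<mu> E" by (intro add_mono hausdorff_measure_mono UE)
    finally show ?thesis .
  qed
  then have "(\<Sum>i. ?\<mu> (R (Suc i))) \<le> ?\<mu> E + ?\<mu> E"
    by (intro suminf_le_const summableI)
  also have "\<dots> < \<infinity>" using fin by simp
  finally have fin_sum: "(\<Sum>i. ?\<mu> (R (Suc i))) < \<infinity>" .
  define \<rho> where "\<rho> i = enn2real (?\<mu> (R (Suc i)))" for i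
  have \<rho>: "?\<mu> (R (Suc i)) = ennreal (\<rho> i)" "0 \<le> \<rho> i" for i
    using fin'[OF order_trans[OF Diff_subset UE], of "Suc (Suc i)" "U (Suc i)"] by (auto simp: \<rho>_def R_def)
  have summ: "summable \<rho>"
    using fin_sum \<rho> by (intro summable_suminf_not_top) (auto simp: less_top)
  \<comment> \<open>\<open>E - K\<close> is covered by \<open>U (Suc i)\<close>, which is separated
    from \<open>K\<close>, and the later annuli, whose total measure is the tail of a convergent
    series.\<close>
  have "?\<mu> (E \<inter> K) + ?\<mu> (E - K) \<le> ?\<mu> E + ennreal (\<Sum>j. \<rho> (j + i))" for i
  proof -
    have "?\<mu> (E - K) \<le> ?\<mu> (U (Suc i) \<union> (\<Union>j. R (Suc i + j)))"
      by (intro hausdorff_measure_mono U_lim)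
    also have "\<dots> \<le> ?\<mu> (U (Suc i)) + (\<Sum>j. ?\<mu> (R (Suc i + j)))"
      by (rule order_trans[OF hausdorff_measure_Un_le]) (intro add_left_mono hausdorff_measure_UN_le)
    also have "(\<Sum>j. ?\<mu> (R (Suc i + j))) = (\<Sum>j. ennreal (\<rho> (j + i)))"
      using \<rho>(1) by (simp add: add.commute)
    also have "\<dots> = ennreal (\<Sum>j. \<rho> (j + i))"
      by (rule suminf_ennreal2) (use \<rho>(2) summ in \<open>auto simp: summable_iff_shift\<close>)
    finally have 1: "?\<mu> (E - K) \<le> ?\<mu> (U (Suc i)) + ennreal (\<Sum>j. \<rho> (j + i))" .
    have "?\<mu> (E \<inter> K) + ?\<mu> (U (Suc i)) \<le> ?\<mu> (E \<inter> K \<union> U (Suc i))"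
    proof (rule hausdorff_measure_separated)
      fix x y assume "x \<in> E \<inter> K" "y \<in> U (Suc i)"
      then show "1 / real (Suc (Suc i)) \<le> dist x y"
        using lip[of y x] by (auto simp: U_def dist_commute)
    qed (use \<open>0 < s\<close> in auto)
    also have "\<dots> \<le> ?\<mu> E" using UE by (intro hausdorff_measure_mono) auto
    finally have "?\<mu> (E \<inter> K) + ?\<mu> (U (Suc i)) + ennreal (\<Sum>j. \<rho> (j + i))
        \<le> ?\<mu> E + ennreal (\<Sum>j. \<rho> (j + i))" by (rule add_right_mono)
    then show ?thesis
      using add_left_mono[OF 1, of "?\<mu> (E \<inter> K)"] unfolding add.assoc by (rule order_trans[rotated])
  qed
  moreover have "(\<lambda>i. ?\<mu> E + ennreal (\<Sum>j. \<rho> (j + i))) \<longlonglongrightarrow> ?\<mu> E + ennreal 0"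
    by (intro tendsto_add tendsto_const tendsto_ennrealI suminf_exist_split2 summ)
  ultimately have "?\<mu> (E \<inter> K) + ?\<mu> (E - K) \<le> ?\<mu> E + ennreal 0"
    by (intro LIMSEQ_le_const) auto
  then show ?thesis by simp
qed simp

text \<open>Finite unions of closed sets are closed, so the pieces can be split off one after the
  other. \<open>E\<close> itself may be any set of finite measure.\<close>

lemma suminf_hausdorff_measure_disjointed_le:
  fixes K :: "nat \<Rightarrow> 'a::metric_space set"
  assumes "\<And>i. closed (K i)" "0 < s" "hausdorff_measure dist s E < \<infinity>"
  shows "(\<Sum>i. hausdorff_measure dist s (E \<inter> disjointed K i)) \<le> hausdorff_measure dist s E"
proof (intro suminf_le_const summableI)
  let ?\<mu> = "hausdorff_measure dist s"
  have fin: "?\<mu> X < \<infinity>" if "X \<subseteq> E" for X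
    using hausdorff_measure_mono[OF that] assms(3) by (rule le_less_trans)
  fix n
  have "(\<Sum>i<n. ?\<mu> (E \<inter> disjointed K i)) \<le> ?\<mu> (E \<inter> (\<Union>i<n. K i))"
  proof (induction n)
    case (Suc n)
    let ?L = "\<Union>i<n. K i" and ?X = "E \<inter> (\<Union>i<Suc n. K i)"
    have "?X \<inter> ?L = E \<inter> ?L" "?X - ?L = E \<inter> disjointed K n"
      by (auto simp: disjointed_def lessThan_Suc atLeast0LessThan)
    then have "?\<mu> (E \<inter> ?L) + ?\<mu> (E \<inter> disjointed K n) \<le> ?\<mu> ?X"
      using hausdorff_measure_closed_split[of ?L s ?X] assms fin[of ?X]
      by (simp add: closed_UN del: Int_UN_distrib)
    then show ?case using add_right_mono[OF Suc, of "?\<mu> (E \<inter> disjointed K n)"]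
      unfolding sum.lessThan_Suc by (rule order_trans[rotated])
  qed simp
  also have "\<dots> \<le> ?\<mu> E" by (intro hausdorff_measure_mono) auto
  finally show "(\<Sum>i<n. ?\<mu> (E \<inter> disjointed K i)) \<le> ?\<mu> E" .
qed

section \<open>Covering slabs around horizontal planes\<close>

text \<open>The deviation of \<open>q\<close> from the horizontal plane at \<open>p\<close>, measured in the direction of the second
  layer.\<close>

definition vdev ::
  "('m::{finite,linorder}, 'k::finite) str \<Rightarrow> ('m, 'k) pt \<Rightarrow> ('m, 'k) pt \<Rightarrow> (real, 'k) vec" where
  "vdev b p q = snd q - snd p - carnot_P b (fst p) (fst q)"

lemma carnot_P_diff_left: "carnot_P b (x - x') y = carnot_P b x y - carnot_P b x' y"
  using bilinear_carnot_P[of b] by (simp add: bilinear_lsub)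

lemma carnot_P_diff_right: "carnot_P b x (y - y') = carnot_P b x y - carnot_P b x y'"
  using bilinear_carnot_P[of b] by (simp add: bilinear_rsub)

text \<open>The left side is the vector inside the second component of \<open>d_inf\<close>. In a
  ball of radius \<open>r\<close> about \<open>p\<close> the bilinear term on the right is of order
  \<open>r\<^sup>2\<close>, so points whose deviations differ by \<open>r\<^sup>2\<close> are at
  homogeneous distance of order \<open>r\<close>.\<close>

lemma vdev_diff:
  "snd q - snd q' + carnot_P b (fst q) (fst q')
     = vdev b p q - vdev b p q' + carnot_P b (fst p - fst q) (fst q - fst q')"
  by (simp add: vdev_def carnot_P_diff_left carnot_P_diff_right)

text \<open>As a function of \<open>q\<close> the deviation is affine, vanishes on the plane, and
  has Lipschitz constant at most \<open>1 + K * norm (fst p)\<close>.\<close>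

lemma norm_vdev_le_dist:
  assumes K: "\<And>x y. norm (carnot_P b x y) \<le> K * norm x * norm y" and z: "z \<in> hplane b p"
  shows "norm (vdev b p q) \<le> (1 + K * norm (fst p)) * dist q z"
proof -
  have K0: "0 \<le> K"
    using order_trans[OF norm_ge_zero K[of "axis undefined 1" "axis undefined 1"]] by simp
  have "vdev b p q = (snd q - snd z) - carnot_P b (fst p) (fst q - fst z)"
    using z by (auto simp: vdev_def hplane_eq carnot_P_diff_right)
  then have "norm (vdev b p q) \<le> norm (snd q - snd z) + norm (carnot_P b (fst p) (fst q - fst z))"
    by (simp only: norm_triangle_ineq4)
  also have "\<dots> \<le> dist q z + K * norm (fst p) * dist q z"
    using dist_snd_le[of q z] dist_fst_le[of q z] K0
    by (intro add_mono order_trans[OF K] mult_left_mono) (auto simp: dist_norm)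
  finally show ?thesis by (simp add: algebra_simps)
qed

text \<open>At most \<open>(5 * l / r) ^ k\<close> cubes of side \<open>r\<^sup>2\<close> meet the
  range of deviations, and each gives a set of homogeneous diameter at most \<open>D * r\<close>;
  the powers \<open>r ^ k\<close> cancel. In \<open>D\<close>, the 2 comes from the first layer,
  \<open>k\<close> from the cube and \<open>2 * K\<close> from the bilinear term of
  \<open>vdev_diff\<close>.\<close>

lemma hausdorff_pre_slab_le:
  fixes b :: "('m::{finite,linorder}, 'k::finite) str" and K c s :: real
  defines "k \<equiv> CARD('k)"
  defines "D \<equiv> 2 + c * sqrt (real k + 2 * K)"
  assumes K: "0 \<le> K" "\<And>x y. norm (carnot_P b x y) \<le> K * norm x * norm y"
    and "0 < c" "0 \<le> s" and r: "0 < r" "r \<le> l" "D * r < \<epsilon>"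
  shows "hausdorff_pre (d_inf b c) (s + real k) \<epsilon> {q. dist p q \<le> r \<and> norm (vdev b p q) \<le> l * r}
      \<le> ennreal (5 ^ k * D powr (s + real k) * l ^ k * r powr s)"
proof -
  let ?S = "{q. dist p q \<le> r \<and> norm (vdev b p q) \<le> l * r}"
  define N where "N = \<lceil>l / r\<rceil>"
  \<comment> \<open>The values of \<^term>\<open>vdev b p\<close> on the slab are sorted into cubes of side \<open>r\<^sup>2\<close>.\<close>
  define I where "I = (UNIV :: 'k set) \<rightarrow>\<^sub>E {- N..N}"
  define T where "T g = {q \<in> ?S. \<forall>j. \<lfloor>vdev b p q $ j / r\<^sup>2\<rfloor> = g j}" for g :: "'k \<Rightarrow> int"
  have D: "0 < D" using \<open>0 < c\<close> K(1) by (simp add: D_def add_pos_nonneg)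
  have finI: "finite I" unfolding I_def by (intro finite_PiE) auto
  have S: "?S \<subseteq> (\<Union>g\<in>I. T g)"
  proof
    fix q assume q: "q \<in> ?S"
    have "\<lfloor>vdev b p q $ j / r\<^sup>2\<rfloor> \<in> {- N..N}" for j
    proof -
      have "\<bar>vdev b p q $ j\<bar> \<le> l * r"
        using component_le_norm_cart[of "vdev b p q" j] q by auto
      then have "\<bar>vdev b p q $ j / r\<^sup>2\<bar> \<le> l / r"
        using r(1) by (simp add: abs_divide field_simps power2_eq_square)
      also have "l / r \<le> of_int N" unfolding N_def by (rule le_of_int_ceiling)
      finally have "\<bar>vdev b p q $ j / r\<^sup>2\<bar> \<le> of_int N" .
      then show ?thesis unfolding atLeastAtMost_iff by linarith
    qed
    then have "(\<lambda>j. \<lfloor>vdev b p q $ j / r\<^sup>2\<rfloor>) \<in> I" by (auto simp: I_def)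
    then show "q \<in> (\<Union>g\<in>I. T g)" using q by (auto simp: T_def)
  qed
  have T: "hausdorff_pre (d_inf b c) (s + real k) \<epsilon> (T g) \<le> ennreal ((D * r) powr (s + real k))" for g
  proof (rule hausdorff_pre_le_single)
    fix q q' assume q: "q \<in> T g" and q': "q' \<in> T g"
    have f: "norm (fst p - fst u) \<le> r" if "u \<in> T g" for u
      using that dist_fst_le[of p u] by (auto simp: T_def dist_norm)
    have fq: "norm (fst q - fst q') \<le> 2 * r"
      using norm_triangle_ineq4[of "fst p - fst q'" "fst p - fst q"] f[OF q] f[OF q'] by simp
    have "\<bar>(vdev b p q - vdev b p q') $ j\<bar> \<le> r\<^sup>2" for j
    proof -
      have "\<lfloor>vdev b p q $ j / r\<^sup>2\<rfloor> = \<lfloor>vdev b p q' $ j / r\<^sup>2\<rfloor>"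
        using q q' by (simp add: T_def)
      then have "\<bar>vdev b p q $ j / r\<^sup>2 - vdev b p q' $ j / r\<^sup>2\<bar> \<le> 1" by linarith
      then show ?thesis using r(1) by (simp add: field_simps flip: diff_divide_distrib)
    qed
    then have "(\<Sum>j\<in>UNIV. \<bar>(vdev b p q - vdev b p q') $ j\<bar>) \<le> (\<Sum>j\<in>(UNIV::'k set). r\<^sup>2)"
      by (rule sum_mono)
    then have v: "norm (vdev b p q - vdev b p q') \<le> k * r\<^sup>2"
      using norm_le_l1_cart[of "vdev b p q - vdev b p q'"] by (simp add: k_def)
    have "K * norm (fst p - fst q) * norm (fst q - fst q') \<le> K * r * (2 * r)"
      using K(1) f[OF q] fq r(1) by (intro mult_mono) auto
    then have "norm (carnot_P b (fst p - fst q) (fst q - fst q')) \<le> 2 * K * r\<^sup>2"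
      using K(2)[of "fst p - fst q" "fst q - fst q'"] by (simp add: power2_eq_square mult_ac)
    with v have "norm (snd q - snd q' + carnot_P b (fst q) (fst q')) \<le> (real k + 2 * K) * r\<^sup>2"
      unfolding vdev_diff[of q q' b p]
      by (intro order_trans[OF norm_triangle_ineq]) (simp add: algebra_simps)
    then have "c * sqrt (norm (snd q - snd q' + carnot_P b (fst q) (fst q')))
        \<le> c * sqrt ((real k + 2 * K) * r\<^sup>2)"
      using \<open>0 < c\<close> by simp
    then have "c * sqrt (norm (snd q - snd q' + carnot_P b (fst q) (fst q')))
        \<le> c * sqrt (real k + 2 * K) * r"
      using r(1) by (simp add: real_sqrt_mult)
    moreover have "0 \<le> c * sqrt (real k + 2 * K) * r" using \<open>0 < c\<close> K(1) r(1) by simp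
    ultimately show "d_inf b c q q' \<le> D * r"
      using fq r(1) by (simp add: d_inf_def D_def algebra_simps)
  next
    show "0 < \<epsilon>" using D r(1,3) by (meson less_trans mult_pos_pos)
  qed (use D r \<open>0 \<le> s\<close> in auto)
  have "card I = nat (2 * N + 1) ^ k"
    unfolding I_def by (subst card_PiE) (auto simp: k_def)
  \<comment> \<open>Since \<open>N < l / r + 1\<close> and \<open>1 <= l / r\<close>, rounding costs
    only a constant factor; this is where \<open>r <= l\<close> enters.\<close>
  moreover have "real (nat (2 * N + 1)) \<le> 5 * l / r"
  proof -
    have "1 \<le> l / r" using r by simp
    moreover have "0 \<le> N" using calculation unfolding N_def by linarith
    moreover have "real_of_int N < l / r + 1" unfolding N_def by linarith
    ultimately show ?thesis by simp
  qed
  ultimately have card: "real (card I) \<le> (5 * l / r) ^ k"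
    by (auto intro: power_mono)
  have "hausdorff_pre (d_inf b c) (s + real k) \<epsilon> ?S
      \<le> hausdorff_pre (d_inf b c) (s + real k) \<epsilon> (\<Union>g\<in>I. T g)"
    by (intro hausdorff_pre_mono S)
  also have "\<dots> \<le> (\<Sum>g\<in>I. hausdorff_pre (d_inf b c) (s + real k) \<epsilon> (T g))"
    using D r(1,3) by (intro hausdorff_pre_UN_finite_le finI) (meson less_trans mult_pos_pos)
  also have "\<dots> \<le> (\<Sum>g\<in>I. ennreal ((D * r) powr (s + real k)))"
    by (intro sum_mono T)
  also have "\<dots> = ennreal (real (card I) * (D * r) powr (s + real k))"
    by (simp add: ennreal_mult ennreal_of_nat_eq_real_of_nat)
  also have "real (card I) * (D * r) powr (s + real k) \<le> (5 * l / r) ^ k * (D * r) powr (s + real k)"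
    by (intro mult_right_mono card) simp
  also have "\<dots> = 5 ^ k * D powr (s + real k) * l ^ k * r powr s"
    using r(1) D by (simp add: powr_mult powr_add powr_realpow power_mult_distrib power_divide)
  finally show ?thesis by (simp add: ennreal_leI)
qed

lemma hausdorff_pre_slabs_le:
  fixes b :: "('m::{finite,linorder}, 'k::finite) str" and K c s :: real
  defines "k \<equiv> CARD('k)"
  defines "D \<equiv> 2 + c * sqrt (real k + 2 * K)"
  assumes K: "0 \<le> K" "\<And>x y. norm (carnot_P b x y) \<le> K * norm x * norm y"
    and "0 < c" "0 \<le> s" "\<And>j. 0 < r j" "\<And>j. r j \<le> l" "\<And>j. D * r j < \<epsilon>"
    and M: "(\<Sum>j. ennreal (r j powr s)) \<le> ennreal M"
    and E: "E \<subseteq> (\<Union>j::nat. {q. dist (p j) q \<le> r j \<and> norm (vdev b (p j) q) \<le> l * r j})"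
  shows "hausdorff_pre (d_inf b c) (s + real k) \<epsilon> E
      \<le> ennreal (5 ^ k * D powr (s + real k) * l ^ k * M)"
proof -
  let ?C = "5 ^ k * D powr (s + real k) * l ^ k"
  have l: "0 \<le> l" using assms(7,8)[of 0] by simp
  have "hausdorff_pre (d_inf b c) (s + real k) \<epsilon> E
      \<le> (\<Sum>j. hausdorff_pre (d_inf b c) (s + real k) \<epsilon>
            {q. dist (p j) q \<le> r j \<and> norm (vdev b (p j) q) \<le> l * r j})"
    by (rule order_trans[OF hausdorff_pre_mono[OF E] hausdorff_pre_UN_le])
  also have "\<dots> \<le> (\<Sum>j. ennreal ?C * ennreal (r j powr s))"
    unfolding k_def D_def
    by (intro suminf_le summableI order_trans[OF hausdorff_pre_slab_le])
       (use assms l in \<open>auto simp: ennreal_mult\<close>)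
  also have "\<dots> \<le> ennreal ?C * ennreal M"
    using M by (simp add: mult_left_mono)
  also have "\<dots> = ennreal (?C * M)"
    using l by (cases "0 \<le> M") (simp_all add: ennreal_mult ennreal_neg mult_nonneg_nonpos)
  finally show ?thesis .
qed

section \<open>The iteration on what the slabs leave uncovered\<close>

text \<open>If \<open>\<kappa>\<close> is an admissible constant for all subsets of
  \<open>F\<close>, then so is \<open>C * l ^ k + 3 / 4 * \<kappa>\<close>: the slabs pay the first
  term, and the remainder has at most three quarters of the mass. The limit of this recursion
  depends neither on \<open>R\<close> nor on \<open>r0\<close>.\<close>

lemma hausdorff_measure_d_inf_le:
  fixes b :: "('m::{finite,linorder}, 'k::finite) str" and K c s :: real
  defines "k \<equiv> CARD('k)"
  defines "C \<equiv> 5 ^ k * (2 + c * sqrt (real k + 2 * K)) powr (s + real k)"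
  assumes K: "0 \<le> K" "\<And>x y. norm (carnot_P b x y) \<le> K * norm x * norm y"
    and "0 < c" "0 < s" "0 < l" "0 < r0"
    and R: "\<And>p. p \<in> F \<Longrightarrow> norm (fst p) \<le> R"
    and sparse: "\<And>p r. p \<in> F \<Longrightarrow> 0 < r \<Longrightarrow> r < r0 \<Longrightarrow>
        hausdorff_measure dist s {q \<in> F. dist p q \<le> r \<and> l * r < norm (vdev b p q)}
          \<le> ennreal (3 / 4 * r powr s)"
    and fin: "hausdorff_measure dist s F < \<infinity>"
  shows "hausdorff_measure (d_inf b c) (s + real k) F
      \<le> ennreal (4 * C * l ^ k) * hausdorff_measure dist s F"
proof (rule hausdorff_measure_leI)
  fix \<epsilon> :: real assume "0 < \<epsilon>"
  let ?\<mu> = "hausdorff_measure dist s"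
  let ?pre = "hausdorff_pre (d_inf b c) (s + real k) \<epsilon>"
  define D where "D = 2 + c * sqrt (real k + 2 * K)"
  have D: "0 < D" using \<open>0 < c\<close> K(1) by (simp add: D_def add_pos_nonneg)
  \<comment> \<open>A Lipschitz constant for the deviation, uniform on \<open>F\<close>. The
    absolute value keeps \<open>1 <= l0\<close> even for negative \<open>R\<close>, which can occur
    when \<open>F\<close> is empty.\<close>
  define l0 where "l0 = 1 + K * \<bar>R\<bar>"
  have l0: "1 \<le> l0" using K(1) by (simp add: l0_def)
  \<comment> \<open>The four bounds serve, in order, \<open>sparse\<close>, the slabs for
    \<open>l\<close>, the slabs for \<open>l0\<close>, and the diameter restriction
    \<open>D * r j < \<epsilon>\<close>.\<close>
  define \<eta> where "\<eta> = Min {r0, l, 1, \<epsilon> / D}"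
  have \<eta>: "0 < \<eta>" "\<eta> \<le> r0" "\<eta> \<le> l" "\<eta> \<le> 1" "\<eta> \<le> \<epsilon> / D"
    using assms \<open>0 < \<epsilon>\<close> D by (auto simp: \<eta>_def)
  have C: "0 \<le> C" by (simp add: C_def)
  \<comment> \<open>The remainder depends on the chosen cover, so the constant must work for every
    subset of \<open>F\<close>. The strict bound \<open>M\<close> leaves the room that the ball
    cover needs.\<close>
  define P where
    "P \<kappa> \<longleftrightarrow> (\<forall>E M. E \<subseteq> F \<longrightarrow> ?\<mu> E < ennreal M \<longrightarrow> ?pre E \<le> ennreal (\<kappa> * M))" for \<kappa>
  have cover: "\<exists>p r. (\<forall>j::nat. p j \<in> E \<and> 0 < r j \<and> r j < \<eta> \<and> D * r j < \<epsilon>) \<and>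
      E \<subseteq> (\<Union>j. cball (p j) (r j)) \<and> (\<Sum>j. ennreal (r j powr s)) < ennreal M"
    if EM: "?\<mu> E < ennreal M" "E \<noteq> {}" for E M
  proof -
    have "hausdorff_pre dist s \<eta> E < ennreal M"
      by (rule le_less_trans[OF hausdorff_pre_le_measure EM(1)]) (rule \<eta>)
    then obtain p r where
      pr: "\<And>j. p j \<in> E" "\<And>j. 0 < r j" "\<And>j. r j < \<eta>" "E \<subseteq> (\<Union>j::nat. cball (p j) (r j))"
        "(\<Sum>j. ennreal (r j powr s)) < ennreal M"
      by (rule hausdorff_pre_ball_cover[OF _ \<eta>(1) EM(2) \<open>0 < s\<close>]) blast
    moreover have "D * r j < \<epsilon>" for j
      using order.strict_trans2[OF pr(3) \<eta>(5), of j] D by (simp add: field_simps)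
    ultimately show ?thesis by blast
  qed
  \<comment> \<open>Every ball is a slab for the large constant \<open>l0\<close>; each application of \<open>PS\<close> brings the
    constant closer to its fixed point \<open>4 * C * l ^ k\<close>.\<close>
  have P0: "P (C * l0 ^ k)"
    unfolding P_def
  proof (intro allI impI)
    fix E M assume E: "E \<subseteq> F" and EM: "?\<mu> E < ennreal M"
    show "?pre E \<le> ennreal (C * l0 ^ k * M)"
    proof (cases "E = {}")
      case False
      from cover[OF EM False] obtain p r where
        pr: "\<And>j. p j \<in> E" "\<And>j. 0 < r j" "\<And>j. r j < \<eta>" "\<And>j. D * r j < \<epsilon>"
          "E \<subseteq> (\<Union>j::nat. cball (p j) (r j))" "(\<Sum>j. ennreal (r j powr s)) < ennreal M"
        by blast
      have "norm (vdev b (p j) q) \<le> l0 * r j" if "dist (p j) q \<le> r j" for j q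
      proof -
        have "norm (vdev b (p j) q) \<le> (1 + K * norm (fst (p j))) * dist q (p j)"
          by (rule norm_vdev_le_dist[OF K(2)]) (simp add: hplane_eq split_beta)
        also have "\<dots> \<le> l0 * r j"
          unfolding l0_def
        proof (intro mult_mono add_left_mono mult_left_mono)
          show "norm (fst (p j)) \<le> \<bar>R\<bar>" using R[of "p j"] pr(1) E by force
        qed (use K(1) that in \<open>auto simp: dist_commute\<close>)
        finally show ?thesis .
      qed
      then have "E \<subseteq> (\<Union>j. {q. dist (p j) q \<le> r j \<and> norm (vdev b (p j) q) \<le> l0 * r j})"
        using pr(5) by (force simp: subset_iff)
      moreover have "r j \<le> l0" for j using pr(3)[of j] \<eta>(4) l0 by simp
      ultimately show ?thesis
        unfolding C_def k_def using K \<open>0 < c\<close> \<open>0 < s\<close> pr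
        by (intro hausdorff_pre_slabs_le) (auto simp: D_def k_def)
    qed (simp add: \<open>0 < \<epsilon>\<close>)
  qed
  have PS: "P (C * l ^ k + 3 / 4 * \<kappa>)" if "P \<kappa>" "0 \<le> \<kappa>" for \<kappa>
    unfolding P_def
  proof (intro allI impI)
    fix E M assume E: "E \<subseteq> F" and EM: "?\<mu> E < ennreal M"
    have M: "0 < M" using EM by (metis ennreal_neg not_less zero_le)
    show "?pre E \<le> ennreal ((C * l ^ k + 3 / 4 * \<kappa>) * M)"
    proof (cases "E = {}")
      case False
      from cover[OF EM False] obtain p r where
        pr: "\<And>j. p j \<in> E" "\<And>j. 0 < r j" "\<And>j. r j < \<eta>" "\<And>j. D * r j < \<epsilon>"
          "E \<subseteq> (\<Union>j::nat. cball (p j) (r j))" "(\<Sum>j. ennreal (r j powr s)) < ennreal M"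
        by blast
      define S where "S = (\<Union>j. {q. dist (p j) q \<le> r j \<and> norm (vdev b (p j) q) \<le> l * r j})"
      have "r j \<le> l" for j using pr(3)[of j] \<eta>(3) by simp
      then have inside: "?pre (E \<inter> S) \<le> ennreal (C * l ^ k * M)"
        unfolding C_def k_def using K \<open>0 < c\<close> \<open>0 < s\<close> pr
        by (intro hausdorff_pre_slabs_le[where p = p and r = r])
          (auto simp: D_def k_def S_def intro: less_imp_le)
      \<comment> \<open>Each point missed by the slabs lies in some ball but outside its slab, where
        \<open>sparse\<close> applies because the centre is in \<open>F\<close>. Thus
        \<open>P \<kappa>\<close> can be used on \<open>E - S\<close> with
        \<open>3 / 4 * M\<close>.\<close>
      have "?\<mu> (E - S)
          \<le> ?\<mu> (\<Union>j. {q \<in> F. dist (p j) q \<le> r j \<and> l * r j < norm (vdev b (p j) q)})"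
        using pr(5) E by (intro hausdorff_measure_mono) (force simp: S_def not_le)
      also have "\<dots> \<le> (\<Sum>j. ?\<mu> {q \<in> F. dist (p j) q \<le> r j \<and> l * r j < norm (vdev b (p j) q)})"
        by (rule hausdorff_measure_UN_le)
      also have "\<dots> \<le> (\<Sum>j. ennreal (3 / 4) * ennreal (r j powr s))"
      proof (intro suminf_le summableI)
        fix j
        have "p j \<in> F" "r j < r0" using E pr(1,3)[of j] \<eta>(2) by auto
        from sparse[OF this(1) pr(2) this(2)]
        show "?\<mu> {q \<in> F. dist (p j) q \<le> r j \<and> l * r j < norm (vdev b (p j) q)}
            \<le> ennreal (3 / 4) * ennreal (r j powr s)"
          by (simp add: ennreal_mult[symmetric])
      qed
      also have "\<dots> < ennreal (3 / 4) * ennreal M"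
        unfolding ennreal_suminf_cmult by (rule ennreal_mult_strict_left_mono[OF pr(6)]) auto
      also have "\<dots> = ennreal (3 / 4 * M)" using M by (simp add: ennreal_mult[symmetric])
      finally have "?pre (E - S) \<le> ennreal (\<kappa> * (3 / 4 * M))"
        using that(1) E unfolding P_def by blast
      with inside have "?pre (E \<inter> S) + ?pre (E - S)
          \<le> ennreal (C * l ^ k * M) + ennreal (\<kappa> * (3 / 4 * M))"
        by (rule add_mono)
      moreover have "?pre E \<le> ?pre (E \<inter> S) + ?pre (E - S)"
        using hausdorff_pre_Un_le[OF \<open>0 < \<epsilon>\<close>, of _ _ "E \<inter> S" "E - S"] by (simp add: Int_Diff_Un)
      ultimately show ?thesis
        using C M that(2) \<open>0 < l\<close> by (auto simp: algebra_simps simp flip: ennreal_plus)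
    qed (simp add: \<open>0 < \<epsilon>\<close>)
  qed
  define a where "a = 4 * C * l ^ k"
  have a: "0 \<le> a" using C \<open>0 < l\<close> by (simp add: a_def)
  \<comment> \<open>The starting constant, and with it \<open>R\<close>, survives only in the
    geometrically decaying term.\<close>
  have Pi: "P (a + (3 / 4) ^ i * (C * l0 ^ k))" for i
  proof (induction i)
    case 0
    show ?case unfolding P_def
    proof (intro allI impI)
      fix E M assume E: "E \<subseteq> F" and EM: "?\<mu> E < ennreal M"
      have "0 < M" using EM by (metis ennreal_neg not_less zero_le)
      then have "C * l0 ^ k * M \<le> (a + (3 / 4) ^ 0 * (C * l0 ^ k)) * M"
        using a by (simp add: algebra_simps)
      moreover have "?pre E \<le> ennreal (C * l0 ^ k * M)" using P0 E EM unfolding P_def by blast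
      ultimately show "?pre E \<le> ennreal ((a + (3 / 4) ^ 0 * (C * l0 ^ k)) * M)"
        using ennreal_leI order_trans by blast
    qed
  next
    case (Suc i)
    have "C * l ^ k + 3 / 4 * (a + (3 / 4) ^ i * (C * l0 ^ k))
        = a + (3 / 4) ^ Suc i * (C * l0 ^ k)" by (simp add: a_def field_simps)
    then show ?case using PS[OF Suc] a C l0 by simp
  qed
  define m where "m = enn2real (?\<mu> F)"
  have m: "?\<mu> F = ennreal m" "0 \<le> m" using fin by (simp_all add: m_def)
  \<comment> \<open>The summand \<open>1 / real (Suc i)\<close> supplies the strict inequality
    demanded by \<open>P\<close> and vanishes in the same limit.\<close>
  define f where "f i = (a + (3 / 4) ^ i * (C * l0 ^ k)) * (m + 1 / real (Suc i))" for i
  have "?pre F \<le> ennreal (f i)" for i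
    using Pi[of i] m unfolding P_def f_def by (simp add: ennreal_less_iff)
  moreover have "(\<lambda>i. ennreal (f i)) \<longlonglongrightarrow> ennreal ((a + 0 * (C * l0 ^ k)) * (m + 0))"
    unfolding f_def by (intro tendsto_intros LIMSEQ_Suc[OF lim_1_over_n] LIMSEQ_realpow_zero) auto
  ultimately have "?pre F \<le> ennreal ((a + 0 * (C * l0 ^ k)) * (m + 0))"
    by (intro LIMSEQ_le_const) auto
  then show "?pre F \<le> ennreal (4 * C * l ^ k) * ?\<mu> F"
    using a m by (simp add: a_def ennreal_mult)
qed

section \<open>Points where the mass concentrates near the horizontal plane\<close>

lemma norm_vdev_le_infdist:
  assumes K: "0 \<le> K" "\<And>x y. norm (carnot_P b x y) \<le> K * norm x * norm y"
  shows "norm (vdev b p q) \<le> (1 + K * norm (fst p)) * infdist q (hplane b p)"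
proof -
  let ?L = "1 + K * norm (fst p)"
  have L: "0 < ?L" using K(1) by (simp add: add_pos_nonneg)
  have "p \<in> hplane b p" by (simp add: hplane_eq split_beta)
  then have ne: "hplane b p \<noteq> {}" by blast
  have "norm (vdev b p q) / ?L \<le> infdist q (hplane b p)"
    unfolding infdist_notempty[OF ne] using norm_vdev_le_dist[OF K(2)] L
    by (intro cINF_greatest ne) (simp add: field_simps)
  then show ?thesis using L by (simp add: field_simps)
qed

text \<open>After multiplication by \<open>(2 * r) powr s\<close> the bound on the upper limit
  becomes half of \<open>r powr s\<close>; the slack between \<open>1 / 2\<close> and
  \<open>5 / 8\<close> makes it hold for all small radii. Thresholds \<open>1 / real (Suc n)\<close>
  sort the points into countably many classes.\<close>

lemma vdev_sparse_of_Limsup_le: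
  fixes b :: "('m::{finite,linorder}, 'k::finite) str" and s :: real
  assumes K: "0 \<le> K" "\<And>x y. norm (carnot_P b x y) \<le> K * norm x * norm y"
    and "0 < l"
    and le: "\<And>\<delta>. 0 < \<delta> \<Longrightarrow>
      Limsup (at_right 0)
        (\<lambda>r. hausdorff_measure dist s ((A \<inter> cball p r) - hplane_nbhd b p (\<delta> * r)) / ennreal ((2 * r) powr s))
      \<le> ennreal (1 / 2 powr (s + 1))"
  shows "\<exists>n. \<forall>r. 0 < r \<longrightarrow> r < 1 / real (Suc n) \<longrightarrow>
      hausdorff_measure dist s {q \<in> A. dist p q \<le> r \<and> l * r < norm (vdev b p q)} \<le> ennreal (5 / 8 * r powr s)"
proof -
  let ?\<mu> = "hausdorff_measure dist s"
  let ?L = "1 + K * norm (fst p)"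
  have L: "0 < ?L" using K(1) by (simp add: add_pos_nonneg)
  \<comment> \<open>With this choice, a deviation above \<open>l * r\<close> forces Euclidean
    distance above \<open>\<delta> * r\<close> from the plane.\<close>
  define \<delta> where "\<delta> = l / ?L"
  have \<delta>: "0 < \<delta>" using L \<open>0 < l\<close> by (simp add: \<delta>_def)
  define X where "X r = (A \<inter> cball p r) - hplane_nbhd b p (\<delta> * r)" for r
  have "ennreal (1 / 2 powr (s + 1)) < ennreal (5 / 8 / 2 powr s)"
    by (simp add: ennreal_less_iff powr_add field_simps)
  then have "\<forall>\<^sub>F r in at_right 0. ?\<mu> (X r) / ennreal ((2 * r) powr s) < ennreal (5 / 8 / 2 powr s)"
    unfolding X_def by (intro Limsup_lessD le_less_trans[OF le] \<delta>)
  then obtain e where e: "0 < e"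
    "\<And>r. 0 < r \<Longrightarrow> r < e \<Longrightarrow> ?\<mu> (X r) / ennreal ((2 * r) powr s) < ennreal (5 / 8 / 2 powr s)"
    unfolding eventually_at_right_field by auto
  obtain n where n: "1 / real (Suc n) < e"
    using reals_Archimedean[OF e(1)] by (auto simp: inverse_eq_divide)
  have "?\<mu> {q \<in> A. dist p q \<le> r \<and> l * r < norm (vdev b p q)} \<le> ennreal (5 / 8 * r powr s)"
    if r: "0 < r" "r < 1 / real (Suc n)" for r
  proof -
    have "{q \<in> A. dist p q \<le> r \<and> l * r < norm (vdev b p q)} \<subseteq> X r"
    proof
      fix q assume q: "q \<in> {q \<in> A. dist p q \<le> r \<and> l * r < norm (vdev b p q)}"
      then have "l * r < ?L * infdist q (hplane b p)"
        using norm_vdev_le_infdist[OF K, of p q] by auto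
      then have "\<delta> * r < infdist q (hplane b p)"
        using L by (simp add: \<delta>_def field_simps)
      then show "q \<in> X r" using q by (auto simp: X_def hplane_nbhd_def)
    qed
    then have "?\<mu> {q \<in> A. dist p q \<le> r \<and> l * r < norm (vdev b p q)} \<le> ?\<mu> (X r)"
      by (rule hausdorff_measure_mono)
    also have "\<dots> \<le> ennreal (5 / 8 / 2 powr s) * ennreal ((2 * r) powr s)"
      using e(2)[of r] r n by (auto simp: divide_less_ennreal intro: less_imp_le)
    also have "\<dots> = ennreal (5 / 8 * r powr s)"
      using r by (simp add: powr_mult flip: ennreal_mult)
    finally show ?thesis .
  qed
  then show ?thesis by blast
qed

text \<open>Passing to the closure costs a factor in the constants; it makes the exceptional set a countable
  union of relatively closed pieces.\<close>

lemma vdev_sparse_closure: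
  fixes b :: "('m::{finite,linorder}, 'k::finite) str" and s :: real
  assumes K: "0 \<le> K" "\<And>x y. norm (carnot_P b x y) \<le> K * norm x * norm y"
    and "0 < l" "0 < s"
    and E: "\<And>p r. p \<in> E \<Longrightarrow> 0 < r \<Longrightarrow> r < e \<Longrightarrow>
      hausdorff_measure dist s {q \<in> A. dist p q \<le> r \<and> l * r < norm (vdev b p q)} \<le> ennreal (5 / 8 * r powr s)"
    and p: "p \<in> closure E" and r: "0 < r" "2 * r < e" "r \<le> 1"
  shows "hausdorff_measure dist s {q \<in> A. dist p q \<le> r \<and> 2 * l * r < norm (vdev b p q)}
    \<le> ennreal (3 / 4 * r powr s)"
proof -
  let ?\<mu> = "hausdorff_measure dist s"
  \<comment> \<open>A Lipschitz constant of the deviation in its base point, valid for all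
    \<open>q\<close> in the unit ball about \<open>p\<close>.\<close>
  define M where "M = 1 + K * (norm (fst p) + 1)"
  have M: "0 < M" using K(1) by (simp add: M_def add_pos_nonneg)
  \<comment> \<open>The first bound gives \<open>r' <= 2 * r < e\<close>, the second gives
    \<open>5 / 8 * (1 + \<eta>) powr s <= 3 / 4\<close>, and the third gives
    \<open>2 * l - M * \<eta> >= l * (1 + \<eta>)\<close>, which absorbs the change of base
    point.\<close>
  define \<eta> where "\<eta> = Min {1, (6 / 5) powr (1 / s) - 1, l / (M + l)}"
  have "1 < (6 / 5 :: real) powr (1 / s)" using \<open>0 < s\<close> by (intro gr_one_powr) auto
  then have \<eta>: "0 < \<eta>" "\<eta> \<le> 1" "\<eta> \<le> (6 / 5) powr (1 / s) - 1" "\<eta> \<le> l / (M + l)"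
    using M \<open>0 < l\<close> by (auto simp: \<eta>_def)
  have \<eta>s: "(1 + \<eta>) powr s \<le> 6 / 5"
  proof -
    have "(1 + \<eta>) powr s \<le> ((6 / 5) powr (1 / s)) powr s"
      using \<eta> \<open>0 < s\<close> by (intro powr_mono2) auto
    then show ?thesis using \<open>0 < s\<close> by (simp add: powr_powr)
  qed
  obtain p' where p': "p' \<in> E" "dist p' p < \<eta> * r"
    using p \<eta>(1) r(1) unfolding closure_approachable by (meson mult_pos_pos)
  define r' where "r' = (1 + \<eta>) * r"
  have "\<eta> * r \<le> r" using \<eta>(2) r(1) mult_right_mono[of \<eta> 1 r] by simp
  then have r': "0 < r'" "r' < e"
    using mult_pos_pos[OF \<eta>(1) r(1)] r unfolding r'_def distrib_right by linarith+
  have "{q \<in> A. dist p q \<le> r \<and> 2 * l * r < norm (vdev b p q)}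
      \<subseteq> {q \<in> A. dist p' q \<le> r' \<and> l * r' < norm (vdev b p' q)}"
  proof safe
    fix q1 q2 assume *: "(q1, q2) \<in> A" "dist p (q1, q2) \<le> r" "2 * l * r < norm (vdev b p (q1, q2))"
    let ?q = "(q1, q2)"
    show "dist p' ?q \<le> r'"
      using dist_triangle[of p' ?q p] p'(2) *(2) by (simp add: r'_def algebra_simps)
    have q1: "norm q1 \<le> norm (fst p) + 1"
      using dist_fst_le[of p ?q] *(2) r(3) norm_triangle_sub[of q1 "fst p"]
      by (simp add: dist_norm norm_minus_commute)
    have "vdev b p ?q - vdev b p' ?q = (snd p' - snd p) + carnot_P b (fst p' - fst p) q1"
      by (simp add: vdev_def carnot_P_diff_left)
    then have "norm (vdev b p ?q - vdev b p' ?q)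
        \<le> norm (snd p' - snd p) + norm (carnot_P b (fst p' - fst p) q1)"
      by (simp only: norm_triangle_ineq)
    also have "\<dots> \<le> dist p' p + K * dist p' p * (norm (fst p) + 1)"
      using dist_snd_le[of p' p] dist_fst_le[of p' p] K(1) q1
      by (intro add_mono order_trans[OF K(2)] mult_mono) (auto simp: dist_norm)
    also have "\<dots> = M * dist p' p" by (simp add: M_def algebra_simps)
    also have "\<dots> \<le> M * (\<eta> * r)" using p'(2) M by simp
    finally have "norm (vdev b p ?q - vdev b p' ?q) \<le> M * (\<eta> * r)" .
    then have 1: "norm (vdev b p ?q) \<le> norm (vdev b p' ?q) + M * (\<eta> * r)"
      using norm_triangle_ineq2[of "vdev b p ?q" "vdev b p' ?q"] by simp
    have "\<eta> * (M + l) \<le> l" using \<eta>(4) M \<open>0 < l\<close> by (simp add: field_simps)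
    then have "\<eta> * (M + l) * r \<le> l * r" using r(1) by (intro mult_right_mono) auto
    then show "l * r' < norm (vdev b p' ?q)"
      using 1 *(3) by (simp add: r'_def algebra_simps)
  qed
  then have "?\<mu> {q \<in> A. dist p q \<le> r \<and> 2 * l * r < norm (vdev b p q)}
      \<le> ?\<mu> {q \<in> A. dist p' q \<le> r' \<and> l * r' < norm (vdev b p' q)}"
    by (rule hausdorff_measure_mono)
  also have "\<dots> \<le> ennreal (5 / 8 * r' powr s)" using p'(1) r' by (rule E)
  also have "5 / 8 * r' powr s = 5 / 8 * (1 + \<eta>) powr s * r powr s"
    using r(1) \<eta>(1) by (simp add: r'_def powr_mult)
  also have "\<dots> \<le> 3 / 4 * r powr s" using \<eta>s by (intro mult_right_mono) auto
  finally show ?thesis by (simp add: ennreal_leI)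
qed

section \<open>Countable decomposition and the limit of thin slabs\<close>

lemma hausdorff_measure_d_inf_eq_0_of_sparse:
  fixes b :: "('m::{finite,linorder}, 'k::finite) str" and s :: real
  assumes "0 < c" "0 < s" and "B \<subseteq> A" and fin: "hausdorff_measure dist s A < \<infinity>"
    and R: "\<And>p. p \<in> B \<Longrightarrow> norm (fst p) \<le> R"
    and le: "\<And>p \<delta>. p \<in> B \<Longrightarrow> 0 < \<delta> \<Longrightarrow>
      Limsup (at_right 0)
        (\<lambda>r. hausdorff_measure dist s ((A \<inter> cball p r) - hplane_nbhd b p (\<delta> * r)) / ennreal ((2 * r) powr s))
      \<le> ennreal (1 / 2 powr (s + 1))"
  shows "hausdorff_measure (d_inf b c) (s + real CARD('k)) B = 0"
proof -
  let ?\<mu> = "hausdorff_measure dist s" and ?H = "hausdorff_measure (d_inf b c) (s + real CARD('k))"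
  obtain K where "K > 0" and K: "\<And>x y. norm (carnot_P b x y) \<le> K * norm x * norm y"
    using bilinear_bounded_pos[OF bilinear_carnot_P] by metis
  then have K0: "0 \<le> K" by simp
  define C where "C = 5 ^ CARD('k) * (2 + c * sqrt (real CARD('k) + 2 * K)) powr (s + real CARD('k))"
  have C: "0 \<le> C" by (simp add: C_def)
  define m where "m = enn2real (?\<mu> A)"
  have m: "?\<mu> A = ennreal m" "0 \<le> m" using fin by (simp_all add: m_def)
  have bound: "?H B \<le> ennreal (4 * C * (2 * l) ^ CARD('k) * m)" if "0 < l" for l
  proof -
    define E where "E n = {p \<in> B. \<forall>r. 0 < r \<longrightarrow> r < 1 / real (Suc n) \<longrightarrow>
      ?\<mu> {q \<in> A. dist p q \<le> r \<and> l * r < norm (vdev b p q)} \<le> ennreal (5 / 8 * r powr s)}" for n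
    \<comment> \<open>Cutting with closures lets the measures of the pieces be summed without loss.
      \<open>F n\<close> may contain points outside \<open>E n\<close>, which is why the constants
      are now \<open>2 * l\<close> and \<open>3 / 4\<close>.\<close>
    define F where "F n = B \<inter> disjointed (\<lambda>n. closure (E n)) n" for n
    have "B \<subseteq> (\<Union>n. E n)"
    proof
      fix p assume "p \<in> B"
      with vdev_sparse_of_Limsup_le[OF K0 K \<open>0 < l\<close> le[OF this]] show "p \<in> (\<Union>n. E n)"
        by (auto simp: E_def)
    qed
    also have "\<dots> \<subseteq> (\<Union>n. closure (E n))" using closure_subset by (intro UN_mono) auto
    finally have BF: "B = (\<Union>n. F n)" by (auto simp: F_def UN_disjointed_eq simp flip: Int_UN_distrib)
    have FB: "F n \<subseteq> B" for n by (auto simp: F_def)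
    have F: "?H (F n) \<le> ennreal (4 * C * (2 * l) ^ CARD('k)) * ?\<mu> (F n)" for n
      unfolding C_def
    proof (rule hausdorff_measure_d_inf_le[OF K0 K \<open>0 < c\<close> \<open>0 < s\<close>])
      \<comment> \<open>The threshold is halved because the passage to the closure needs
        \<open>2 * r\<close> below that of \<open>E n\<close>.\<close>
      show "0 < 1 / (2 * real (Suc n))" by simp
      show "?\<mu> (F n) < \<infinity>"
        using hausdorff_measure_mono[OF order_trans[OF FB \<open>B \<subseteq> A\<close>]] fin by (rule le_less_trans)
      fix p r assume p: "p \<in> F n" and r: "0 < r" "r < 1 / (2 * real (Suc n))"
      have "p \<in> closure (E n)" using p disjointed_subset[of "\<lambda>n. closure (E n)" n] by (auto simp: F_def)
      moreover have "2 * r < 1 / real (Suc n)" using r by (simp add: field_simps)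
      moreover have "r \<le> 1" using r(2) by (rule less_imp_le[OF order.strict_trans2]) (simp add: field_simps)
      ultimately have "?\<mu> {q \<in> A. dist p q \<le> r \<and> 2 * l * r < norm (vdev b p q)}
          \<le> ennreal (3 / 4 * r powr s)"
        using r(1) by (intro vdev_sparse_closure[OF K0 K \<open>0 < l\<close> \<open>0 < s\<close>, where E = "E n"]) (auto simp: E_def)
      moreover have "?\<mu> {q \<in> F n. dist p q \<le> r \<and> 2 * l * r < norm (vdev b p q)}
          \<le> ?\<mu> {q \<in> A. dist p q \<le> r \<and> 2 * l * r < norm (vdev b p q)}"
        using FB \<open>B \<subseteq> A\<close> by (intro hausdorff_measure_mono) auto
      ultimately show "?\<mu> {q \<in> F n. dist p q \<le> r \<and> 2 * l * r < norm (vdev b p q)}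
          \<le> ennreal (3 / 4 * r powr s)" by (rule order_trans[rotated])
    qed (use R FB \<open>0 < l\<close> in auto)
    have "?H B \<le> (\<Sum>n. ?H (F n))" by (subst BF) (rule hausdorff_measure_UN_le)
    also have "\<dots> \<le> (\<Sum>n. ennreal (4 * C * (2 * l) ^ CARD('k)) * ?\<mu> (F n))"
      by (intro suminf_le summableI F)
    also have "\<dots> \<le> ennreal (4 * C * (2 * l) ^ CARD('k)) * ?\<mu> B"
      using suminf_hausdorff_measure_disjointed_le[of "\<lambda>n. closure (E n)" s B]
        hausdorff_measure_mono[OF \<open>B \<subseteq> A\<close>, of dist s] fin \<open>0 < s\<close>
      by (auto simp: F_def intro!: mult_left_mono)
    also have "\<dots> \<le> ennreal (4 * C * (2 * l) ^ CARD('k)) * ennreal m"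
      unfolding m(1)[symmetric] by (intro mult_left_mono hausdorff_measure_mono \<open>B \<subseteq> A\<close>) simp
    also have "\<dots> = ennreal (4 * C * (2 * l) ^ CARD('k) * m)"
      using C m(2) \<open>0 < l\<close> by (simp add: ennreal_mult)
    finally show ?thesis .
  qed
  \<comment> \<open>\<open>C\<close> and \<open>m\<close> do not depend on \<open>l\<close>, and
    \<open>CARD('k)\<close> is positive, so the bound tends to 0 with \<open>l\<close>.\<close>
  have "(\<lambda>i. ennreal (4 * C * (2 * (1 / real (Suc i))) ^ CARD('k) * m))
      \<longlonglongrightarrow> ennreal (4 * C * (2 * 0) ^ CARD('k) * m)"
    by (intro tendsto_intros LIMSEQ_Suc[OF lim_1_over_n])
  then have "?H B \<le> ennreal (4 * C * (2 * 0) ^ CARD('k) * m)"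
    by (rule LIMSEQ_le_const) (intro exI allI impI bound, simp)
  then show ?thesis by (simp add: zero_power)
qed

theorem theorem2:
  fixes b :: "'k::finite \<Rightarrow> 'm::{finite,linorder} \<Rightarrow> 'm \<Rightarrow> real"
    and c s :: real
    and A :: "((real, 'm) vec \<times> (real, 'k) vec) set"
  assumes "carnot_step2 b"
    and "0 < c" and "c < 1" and "Metric_space UNIV (d_inf b c)"
    and "real CARD('k) \<le> s"
    and "hausdorff_measure dist s A < \<infinity>"
  shows "hausdorff_measure (d_inf b c) (s + real CARD('k))
           {p \<in> A. \<not> (\<exists>\<delta>>0.
              Limsup (at_right 0)
                (\<lambda>r. hausdorff_measure dist s ((A \<inter> cball p r) - hplane_nbhd b p (\<delta> * r))
                       / ennreal ((2 * r) powr s))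
              > ennreal (1 / 2 powr (s + 1)))} = 0"
    (is "hausdorff_measure _ _ ?B = 0")
proof -
  let ?H = "hausdorff_measure (d_inf b c) (s + real CARD('k))"
  have s: "0 < s" using \<open>real CARD('k) \<le> s\<close> by (rule less_le_trans[rotated]) simp
  \<comment> \<open>The Lipschitz constant of the deviation grows with \<open>norm (fst p)\<close>,
    so the exceptional set is exhausted by parts on which this norm is bounded.\<close>
  have null: "?H {p \<in> ?B. norm (fst p) \<le> real n} = 0" for n :: nat
    by (rule hausdorff_measure_d_inf_eq_0_of_sparse[OF \<open>0 < c\<close> s _ assms(6), where R = "real n"])
      (blast intro: leI)+
  have "?B = (\<Union>n::nat. {p \<in> ?B. norm (fst p) \<le> real n})"
    using real_arch_simple by blast
  then have "?H ?B = ?H (\<Union>n::nat. {p \<in> ?B. norm (fst p) \<le> real n})" by (rule arg_cong)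
  also have "\<dots> \<le> (\<Sum>n. ?H {p \<in> ?B. norm (fst p) \<le> real n})" by (rule hausdorff_measure_UN_le)
  also have "\<dots> = 0" by (simp only: null) simp
  finally show ?thesis by simp
qed

end
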